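(* Let $\theta\in\mathbb{R}$, $\tau\ge0$, $q\in(-1,1)$ and fix $x\in\mathbb{R}$. For $0\le s<t$ the measures $$\frac{(y-x)^2}{t-s}P_{s,t}(x,dy)$$ are probability measures. For every fixed $t>0$ they converge weakly, as $s\to t^-$, to $\nu_{x,t}(dy)$. Similarly, for every fixed $s>0$ they converge weakly, as $t\to s^+$, to $\nu_{x,s}(dy)$.
   Context: Notation: $[n]_q=\sum_{j=0}^{n-1}q^j$ (so $[0]_q=0$). For $0\le s<t$ and $x\in\mathbb{R}$, let $Q_n(y|x,s,t)$ be the polynomials in $y$ given by $Q_{-1}=0$, $Q_0=1$, $Q_1(y|x,s,t)=y-x$ and, for $n\ge1$, $$yQ_n(y|x,s,t)=Q_{n+1}(y|x,s,t)+(\theta[n]_q+xq^n)Q_n(y|x,s,t)+(t-sq^{n-1}+\tau[n-1]_q)[n]_qQ_{n-1}(y|x,s,t).$$ $P_{s,t}(x,dy)$ is the unique probability measure with respect to which these polynomials are orthogonal (the transition probabilities of the $q$-Meixner process with parameters $\theta,\tau,q$). For $x\in\mathbb{R}$, $t>0$, $\nu_{x,t}(dy)$ is the (compactly supported, unique) probability measure with respect to which the following monic polynomials in $y$ are orthogonal: $W_{-1}=0$, $W_0=1$, and for $n\ge0$ $$yW_n(y;x,t)=W_{n+1}(y;x,t)+(\theta[n+1]_q+xq^{n+1})W_n(y;x,t)+((1-q)t+\tau)[n]_q[n+1]_qW_{n-1}(y;x,t).$$ *)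

theory Defs
  imports "HOL-Probability.Probability" "HOL-Computational_Algebra.Polynomial"
begin

definition q_int :: "real \<Rightarrow> nat \<Rightarrow> real" where
  "q_int q n = (\<Sum>j<n. q ^ j)"

text \<open>
  The polynomials \<open>Q\<^sub>n(y|x,s,t)\<close> and \<open>W\<^sub>n(y;x,t)\<close>, as polynomials in \<open>y\<close>. The three-term
  recurrences are solved for the polynomial of highest index and shifted by one; the lemmas
  \<open>meixner_Q_recurrence\<close>, \<open>meixner_W_0\<close> and \<open>meixner_W_recurrence\<close> give the usual form.
\<close>

fun meixner_Q :: "real \<Rightarrow> real \<Rightarrow> real \<Rightarrow> real \<Rightarrow> real \<Rightarrow> real \<Rightarrow> nat \<Rightarrow> real poly" where
  "meixner_Q \<theta> \<tau> q x s t 0 = 1"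
| "meixner_Q \<theta> \<tau> q x s t (Suc 0) = [:-x, 1:]"
| "meixner_Q \<theta> \<tau> q x s t (Suc (Suc n)) =
     [:-(\<theta> * q_int q (Suc n) + x * q ^ Suc n), 1:] * meixner_Q \<theta> \<tau> q x s t (Suc n)
     - smult ((t - s * q ^ n + \<tau> * q_int q n) * q_int q (Suc n)) (meixner_Q \<theta> \<tau> q x s t n)"

fun meixner_W :: "real \<Rightarrow> real \<Rightarrow> real \<Rightarrow> real \<Rightarrow> real \<Rightarrow> nat \<Rightarrow> real poly" where
  "meixner_W \<theta> \<tau> q x t 0 = 1"
| "meixner_W \<theta> \<tau> q x t (Suc 0) = [:-(\<theta> * q_int q 1 + x * q), 1:]"
| "meixner_W \<theta> \<tau> q x t (Suc (Suc n)) =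
     [:-(\<theta> * q_int q (Suc (Suc n)) + x * q ^ Suc (Suc n)), 1:] * meixner_W \<theta> \<tau> q x t (Suc n)
     - smult (((1 - q) * t + \<tau>) * q_int q (Suc n) * q_int q (Suc (Suc n)))
         (meixner_W \<theta> \<tau> q x t n)"

lemma meixner_Q_recurrence:
  assumes "n \<ge> 1"
  shows "y * poly (meixner_Q \<theta> \<tau> q x s t n) y =
      poly (meixner_Q \<theta> \<tau> q x s t (n + 1)) y
      + (\<theta> * q_int q n + x * q ^ n) * poly (meixner_Q \<theta> \<tau> q x s t n) y
      + (t - s * q ^ (n - 1) + \<tau> * q_int q (n - 1)) * q_int q n
          * poly (meixner_Q \<theta> \<tau> q x s t (n - 1)) y"
  using assms by (cases n) (simp_all add: algebra_simps)

lemma meixner_W_0: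
  "y * poly (meixner_W \<theta> \<tau> q x t 0) y =
      poly (meixner_W \<theta> \<tau> q x t 1) y
      + (\<theta> * q_int q 1 + x * q ^ 1) * poly (meixner_W \<theta> \<tau> q x t 0) y"
  by (simp add: algebra_simps)

lemma meixner_W_recurrence:
  assumes "n \<ge> 1"
  shows "y * poly (meixner_W \<theta> \<tau> q x t n) y =
      poly (meixner_W \<theta> \<tau> q x t (n + 1)) y
      + (\<theta> * q_int q (n + 1) + x * q ^ (n + 1)) * poly (meixner_W \<theta> \<tau> q x t n) y
      + ((1 - q) * t + \<tau>) * q_int q n * q_int q (n + 1)
          * poly (meixner_W \<theta> \<tau> q x t (n - 1)) y"
  using assms by (cases n) (simp_all add: algebra_simps)

text \<open>
  Integrability is demanded explicitly, since the Bochner integral of a non-integrable function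
  is \<open>0\<close>.
\<close>

definition orthogonality_measure :: "(nat \<Rightarrow> real poly) \<Rightarrow> real measure \<Rightarrow> bool" where
  "orthogonality_measure p M \<longleftrightarrow>
     real_distribution M \<and>
     (\<forall>m n. integrable M (\<lambda>y. poly (p m) y * poly (p n) y)) \<and>
     (\<forall>m n. m \<noteq> n \<longrightarrow> (\<integral>y. poly (p m) y * poly (p n) y \<partial>M) = 0)"

definition meixner_P :: "real \<Rightarrow> real \<Rightarrow> real \<Rightarrow> real \<Rightarrow> real \<Rightarrow> real \<Rightarrow> real measure" where
  "meixner_P \<theta> \<tau> q s t x = (THE M. orthogonality_measure (meixner_Q \<theta> \<tau> q x s t) M)"

definition meixner_nu :: "real \<Rightarrow> real \<Rightarrow> real \<Rightarrow> real \<Rightarrow> real \<Rightarrow> real measure" where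
  "meixner_nu \<theta> \<tau> q x t = (THE M. orthogonality_measure (meixner_W \<theta> \<tau> q x t) M)"

definition meixner_quadratic :: "real \<Rightarrow> real \<Rightarrow> real \<Rightarrow> real \<Rightarrow> real \<Rightarrow> real \<Rightarrow> real measure" where
  "meixner_quadratic \<theta> \<tau> q s t x =
     density (meixner_P \<theta> \<tau> q s t x) (\<lambda>y. ennreal ((y - x)\<^sup>2 / (t - s)))"

text \<open>
  Weak convergence of Borel probability measures on the line along an arbitrary filter. The
  library's \<^const>\<open>weak_conv_m\<close> is for sequences only; the two agree there.
\<close>

definition converges_weakly :: "('i \<Rightarrow> real measure) \<Rightarrow> real measure \<Rightarrow> 'i filter \<Rightarrow> bool" where
  "converges_weakly \<mu> M F \<longleftrightarrow>
     (\<forall>\<^sub>F i in F. real_distribution (\<mu> i)) \<and> real_distribution M \<and>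
     (\<forall>f :: real \<Rightarrow> real. continuous_on UNIV f \<and> bounded (range f) \<longrightarrow>
        ((\<lambda>i. integral\<^sup>L (\<mu> i) f) \<longlongrightarrow> integral\<^sup>L M f) F)"

lemma converges_weakly_sequentially:
  assumes "\<And>n. real_distribution (\<mu> n)" "real_distribution M"
  shows "converges_weakly \<mu> M sequentially \<longleftrightarrow> weak_conv_m \<mu> M"
proof
  assume *: "converges_weakly \<mu> M sequentially"
  show "weak_conv_m \<mu> M"
  proof (rule integral_bdd_continuous_conv_imp_weak_conv[OF assms])
    fix f :: "real \<Rightarrow> real"
    assume "\<And>x. isCont f x" "\<And>x. \<bar>f x\<bar> \<le> 1"
    then have "continuous_on UNIV f" "bounded (range f)"
      by (auto simp: continuous_on_eq_continuous_at bounded_iff)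
    with * show "(\<lambda>n. integral\<^sup>L (\<mu> n) f) \<longlonglongrightarrow> integral\<^sup>L M f"
      by (simp add: converges_weakly_def)
  qed
next
  assume *: "weak_conv_m \<mu> M"
  have "(\<lambda>n. integral\<^sup>L (\<mu> n) f) \<longlonglongrightarrow> integral\<^sup>L M f"
    if "continuous_on UNIV f" "bounded (range f)" for f :: "real \<Rightarrow> real"
  proof -
    from that(2) obtain B where "\<And>x. norm (f x) \<le> B"
      by (auto simp: bounded_iff)
    with that(1) show ?thesis
      by (intro weak_conv_imp_integral_bdd_continuous_conv[OF assms *])
         (auto simp: continuous_on_eq_continuous_at)
  qed
  with assms show "converges_weakly \<mu> M sequentially"
    by (simp add: converges_weakly_def)
qed

end

theory Submission
  imports Defs "HOL-Real_Asymp.Real_Asymp"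
begin

text \<open>
  The measure \<open>P\<^sub>s\<^sub>,\<^sub>t\<close> is the spectral measure, at the zeroth unit vector \<open>e\<^sub>0\<close>, of the tridiagonal
  operator \<open>T\<close> formed from the recurrence coefficients of the polynomials \<open>Q\<^sub>n\<close>. Since \<open>Q\<^sub>1 = y - x\<close>
  has squared norm \<open>t - s\<close>, the measure \<open>(y - x)\<^sup>2 / (t - s) P\<^sub>s\<^sub>,\<^sub>t\<close> is the spectral measure
  at \<open>e\<^sub>1\<close>, so it is a probability measure, and its \<open>k\<close>-th moment is the entry \<open>(1, 1)\<close> of \<open>T\<^sup>k\<close>, a
  polynomial in the coefficients (\<open>orthogonality_measure_quadratic_moment\<close>).
  As \<open>s\<close> and \<open>t\<close> approach a common value, so do these moments. In the limit the coefficient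
  \<open>t - s\<close> that couples \<open>e\<^sub>0\<close> to the other unit vectors vanishes, and deleting the zeroth row and column
  of \<open>T\<close> leaves exactly the operator of the polynomials \<open>W\<^sub>n\<close>
  (\<open>jacobi_op_power_decoupled\<close>, \<open>meixner_W_eq_jacobi\<close>). Hence the moments converge to those of
  \<open>\<nu>\<close>. All coefficients are bounded uniformly, so all measures live on one bounded interval, where
  convergence of moments implies weak convergence (\<open>tendsto_integral_of_moments\<close>).

  The measures are given by definite description, so this rests on Favard's theorem with bounded
  coefficients (\<open>orthogonality_measure_The\<close>). For uniqueness, orthogonality determines all
  moments, and moments determine a distribution on a bounded interval
  (\<open>real_distribution_determined_by_moments\<close>). For existence, the functional \<open>L\<close> that reads off the
  coefficient of \<open>Q\<^sub>0\<close> is positive and satisfies \<open>L (y\<^sup>2 p\<^sup>2) \<le> C\<^sup>2 L (p\<^sup>2)\<close>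
  (\<open>jacobi_functional_mult\<close>, \<open>jacobi_op_bounded\<close>). This makes it nonnegative on the
  products \<open>(C + y)\<^sup>j (C - y)\<^sup>k\<close> (\<open>positive_functional_represented\<close>), and Hausdorff's theorem, proved
  with Bernstein polynomials and Helly's selection theorem, provides the measure
  (\<open>hausdorff_moment_problem\<close>).
\<close>

section \<open>Distributions on a bounded interval and their moments\<close>

lemma integrable_continuous_AE_bounded:
  fixes f :: "real \<Rightarrow> real"
  assumes "real_distribution M" and supp: "AE y in M. \<bar>y\<bar> \<le> C" and f: "continuous_on UNIV f"
  shows "integrable M f"
proof -
  interpret real_distribution M by fact
  have [measurable]: "f \<in> borel_measurable borel"
    using f by (rule borel_measurable_continuous_onI)
  have "bounded (f ` {-C..C})"
    by (intro compact_imp_bounded compact_continuous_image continuous_on_subset[OF f]) auto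
  then obtain B where B: "\<forall>z\<in>f ` {-C..C}. norm z \<le> B"
    unfolding bounded_iff by blast
  show ?thesis
  proof (rule integrable_const_bound)
    show "AE y in M. norm (f y) \<le> B"
      using supp by eventually_elim (use B in \<open>auto simp: abs_le_iff\<close>)
  qed simp
qed

lemma polynomial_approximation_interval:
  fixes f :: "real \<Rightarrow> real"
  assumes "continuous_on UNIV f" "0 < e"
  obtains p where "\<And>y. \<bar>y\<bar> \<le> C \<Longrightarrow> \<bar>f y - poly p y\<bar> < e"
proof -
  obtain g where g: "real_polynomial_function g" "\<And>y. y \<in> {-C..C} \<Longrightarrow> \<bar>f y - g y\<bar> < e"
    using Stone_Weierstrass_real_polynomial_function[of "{-C..C}" f e] assms
    by (metis compact_Icc continuous_on_subset top_greatest)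
  obtain a n where "g = (\<lambda>x. \<Sum>i\<le>n. a i * x ^ i)"
    using real_polynomial_function_imp_sum[OF g(1)] by blast
  then have "poly (\<Sum>i\<le>n. monom (a i) i) y = g y" for y
    by (simp add: poly_sum poly_monom)
  with g(2) show ?thesis
    by (intro that[of "\<Sum>i\<le>n. monom (a i) i"]) (auto simp: abs_le_iff)
qed

lemma continuous_on_poly_UNIV: "continuous_on UNIV (poly p)" for p :: "real poly"
  by (intro continuous_intros)

lemma integral_poly_moments:
  assumes "\<And>k. integrable M (\<lambda>y::real. y ^ k)"
  shows "integral\<^sup>L M (poly p) = (\<Sum>k\<le>degree p. coeff p k * (\<integral>y. y ^ k \<partial>M))"
  using assms by (simp add: poly_altdef[abs_def])

text \<open>
  The common interval \<open>[-C, C]\<close> is what makes this true: one polynomial approximates \<open>f\<close> there, hence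
  in the mean of all the measures simultaneously.
\<close>
lemma tendsto_integral_of_moments:
  fixes f :: "real \<Rightarrow> real"
  assumes dist: "\<forall>\<^sub>F i in F. real_distribution (\<mu> i) \<and> (AE y in \<mu> i. \<bar>y\<bar> \<le> C)"
    and M: "real_distribution M" "AE y in M. \<bar>y\<bar> \<le> C"
    and mom: "\<And>k. ((\<lambda>i. \<integral>y. y ^ k \<partial>\<mu> i) \<longlongrightarrow> (\<integral>y. y ^ k \<partial>M)) F"
    and f: "continuous_on UNIV f"
  shows "((\<lambda>i. integral\<^sup>L (\<mu> i) f) \<longlongrightarrow> integral\<^sup>L M f) F"
proof (rule tendstoI)
  fix e :: real assume e: "0 < e"
  obtain p where p: "\<And>y. \<bar>y\<bar> \<le> C \<Longrightarrow> \<bar>f y - poly p y\<bar> < e / 3"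
    using polynomial_approximation_interval[OF f, of "e / 3" C] e by auto
  have approx: "\<bar>integral\<^sup>L N f - integral\<^sup>L N (poly p)\<bar> \<le> e / 3"
    if N: "real_distribution N" "AE y in N. \<bar>y\<bar> \<le> C" for N
  proof -
    interpret N: real_distribution N by fact
    have int: "integrable N f" "integrable N (poly p)"
      by (rule integrable_continuous_AE_bounded[OF N] f continuous_on_poly_UNIV)+
    have "\<bar>integral\<^sup>L N f - integral\<^sup>L N (poly p)\<bar> = \<bar>\<integral>y. f y - poly p y \<partial>N\<bar>"
      using int by simp
    also have "\<dots> \<le> (\<integral>y. \<bar>f y - poly p y\<bar> \<partial>N)"
      by (rule integral_abs_bound)
    also have "\<dots> \<le> (\<integral>y. e / 3 \<partial>N)"
      using int N(2) by (intro integral_mono_AE) (auto elim!: eventually_mono dest: p)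
    finally show ?thesis
      using N.prob_space by simp
  qed
  have pow: "integrable N (\<lambda>y. y ^ k)"
    if N: "real_distribution N" "AE y in N. \<bar>y\<bar> \<le> C" for N k
    by (rule integrable_continuous_AE_bounded[OF N]) (intro continuous_intros)
  have "((\<lambda>i. \<Sum>k\<le>degree p. coeff p k * (\<integral>y. y ^ k \<partial>\<mu> i)) \<longlongrightarrow> integral\<^sup>L M (poly p)) F"
    unfolding integral_poly_moments[OF pow[OF M]] by (intro tendsto_intros mom)
  then have "\<forall>\<^sub>F i in F. dist (\<Sum>k\<le>degree p. coeff p k * (\<integral>y. y ^ k \<partial>\<mu> i))
      (integral\<^sup>L M (poly p)) < e / 3"
    using e by (intro tendstoD) auto
  then show "\<forall>\<^sub>F i in F. dist (integral\<^sup>L (\<mu> i) f) (integral\<^sup>L M f) < e"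
    using dist
  proof eventually_elim
    case (elim i)
    then have "integral\<^sup>L (\<mu> i) (poly p) = (\<Sum>k\<le>degree p. coeff p k * (\<integral>y. y ^ k \<partial>\<mu> i))"
      by (intro integral_poly_moments pow) auto
    with elim have "\<bar>integral\<^sup>L (\<mu> i) (poly p) - integral\<^sup>L M (poly p)\<bar> < e / 3"
      by (simp add: dist_real_def)
    moreover have "\<bar>integral\<^sup>L (\<mu> i) f - integral\<^sup>L (\<mu> i) (poly p)\<bar> \<le> e / 3"
      using elim by (intro approx) auto
    ultimately show ?case
      using approx[OF M] unfolding dist_real_def by linarith
  qed
qed

text \<open>
  A distribution with the moments of a distribution on \<open>[-C, C]\<close> lives on \<open>[-C, C]\<close> itself:
  by Markov's inequality the mass outside \<open>[-r, r]\<close> is at most \<open>(C / r)\<^sup>2\<^sup>k\<close> for every \<open>k\<close>.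
\<close>
lemma AE_bounded_of_moments:
  fixes C :: real
  assumes "real_distribution M" and int: "\<And>k. integrable M (\<lambda>y. y ^ k)"
    and C: "0 < C" and mom: "\<And>k. (\<integral>y. y ^ (2 * k) \<partial>M) \<le> C ^ (2 * k)"
  shows "AE y in M. \<bar>y\<bar> \<le> C"
proof -
  interpret real_distribution M by fact
  have null: "prob {y. r \<le> \<bar>y\<bar>} = 0" if "C < r" for r
  proof -
    have "prob {y. r \<le> \<bar>y\<bar>} \<le> (C / r) ^ (2 * k)" for k
    proof -
      have "{y. r \<le> \<bar>y\<bar>} \<subseteq> {y \<in> space M. r ^ (2 * k) \<le> y ^ (2 * k)}"
        using power_mono[of r _ "2 * k"] C that
        by (auto simp: power_even_abs) (metis dual_order.strict_trans even_mult_iff even_numeral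
            less_le power_even_abs)
      then have "prob {y. r \<le> \<bar>y\<bar>} \<le> prob {y \<in> space M. r ^ (2 * k) \<le> y ^ (2 * k)}"
        by (intro finite_measure_mono) measurable
      also have "\<dots> \<le> (\<integral>y. y ^ (2 * k) \<partial>M) / r ^ (2 * k)"
        using C that by (intro integral_Markov_inequality_measure[where A = "{}"] int) auto
      also have "\<dots> \<le> C ^ (2 * k) / r ^ (2 * k)"
        using C that by (intro divide_right_mono mom) auto
      finally show ?thesis
        by (simp add: power_divide)
    qed
    moreover have "(\<lambda>k. (C / r) ^ (2 * k)) \<longlonglongrightarrow> 0"
      using C that by (simp add: power_mult, intro LIMSEQ_power_zero) (auto simp: abs_square_less_1)
    ultimately have "prob {y. r \<le> \<bar>y\<bar>} \<le> 0"
      by (intro LIMSEQ_le_const) auto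
    then show ?thesis
      using measure_nonneg[of M "{y. r \<le> \<bar>y\<bar>}"] by simp
  qed
  have "AE y in M. \<bar>y\<bar> < C + 1 / real (Suc n)" for n
    using null[of "C + 1 / real (Suc n)"]
    by (subst AE_iff_measurable[OF _ refl]) (auto simp: emeasure_eq_measure not_less)
  then have "AE y in M. \<forall>n. \<bar>y\<bar> < C + 1 / real (Suc n)"
    by (simp add: AE_all_countable)
  then show ?thesis
  proof eventually_elim
    case (elim y)
    show ?case
    proof (rule ccontr)
      assume "\<not> \<bar>y\<bar> \<le> C"
      then obtain n where "1 / real (Suc n) < \<bar>y\<bar> - C"
        using reals_Archimedean[of "\<bar>y\<bar> - C"] by (auto simp: inverse_eq_divide)
      with elim[rule_format, of n] show False by simp
    qed
  qed
qed

lemma real_distribution_determined_by_moments: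
  fixes C :: real
  assumes "real_distribution N" and supp: "AE y in N. \<bar>y\<bar> \<le> C" and C: "0 < C"
    and "real_distribution M" and int: "\<And>k. integrable M (\<lambda>y. y ^ k)"
    and mom: "\<And>k. (\<integral>y. y ^ k \<partial>M) = (\<integral>y. y ^ k \<partial>N)"
  shows "M = N"
proof -
  interpret N: real_distribution N by fact
  interpret M: real_distribution M by fact
  have suppM: "AE y in M. \<bar>y\<bar> \<le> C"
  proof (rule AE_bounded_of_moments[OF assms(4) int C])
    fix k
    have "(\<integral>y. y ^ (2 * k) \<partial>N) \<le> (\<integral>y. C ^ (2 * k) \<partial>N)"
    proof (rule integral_mono_AE)
      show "integrable N (\<lambda>y. y ^ (2 * k))"
        by (rule integrable_continuous_AE_bounded[OF assms(1) supp]) (intro continuous_intros)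
      show "AE y in N. y ^ (2 * k) \<le> C ^ (2 * k)"
        using supp
      proof eventually_elim
        case (elim y)
        then have "\<bar>y\<bar> ^ (2 * k) \<le> C ^ (2 * k)"
          by (intro power_mono) auto
        then show ?case
          by (simp add: power_even_abs)
      qed
    qed simp
    then show "(\<integral>y. y ^ (2 * k) \<partial>M) \<le> C ^ (2 * k)"
      using N.prob_space by (simp add: mom)
  qed
  have eq: "integral\<^sup>L M f = integral\<^sup>L N f" if "continuous_on UNIV f" for f :: "real \<Rightarrow> real"
  proof -
    have "((\<lambda>i::nat. integral\<^sup>L M f) \<longlonglongrightarrow> integral\<^sup>L N f)"
    proof (rule tendsto_integral_of_moments[OF _ assms(1) supp _ that])
      show "\<forall>\<^sub>F i in sequentially. real_distribution M \<and> (AE y in M. \<bar>y\<bar> \<le> C)"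
        using assms(4) suppM by simp
      show "((\<lambda>i::nat. \<integral>y. y ^ k \<partial>M) \<longlonglongrightarrow> (\<integral>y. y ^ k \<partial>N))" for k
        unfolding mom by (rule tendsto_const)
    qed
    then show ?thesis
      by (simp add: LIMSEQ_const_iff)
  qed
  \<comment> \<open>The characteristic functions agree, since their real and imaginary parts integrate \<open>cos\<close> and \<open>sin\<close>.\<close>
  have "char M t = char N t" for t
  proof -
    have iM: "integrable M (\<lambda>x. iexp (t * x))"
      by (rule M.integrable_const_bound[where B = 1]) auto
    have iN: "integrable N (\<lambda>x. iexp (t * x))"
      by (rule N.integrable_const_bound[where B = 1]) auto
    have "(\<integral>x. cos (t * x) \<partial>M) = (\<integral>x. cos (t * x) \<partial>N)"
      "(\<integral>x. sin (t * x) \<partial>M) = (\<integral>x. sin (t * x) \<partial>N)"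
      by (intro eq continuous_intros)+
    then show ?thesis
      using integral_Re[OF iM] integral_Im[OF iM] integral_Re[OF iN] integral_Im[OF iN]
      by (intro complex_eqI) (simp_all add: char_def Re_exp Im_exp)
  qed
  then show ?thesis
    by (intro Levy_uniqueness assms) auto
qed

section \<open>The Hausdorff moment problem\<close>

text \<open>
  The Bernstein polynomials \<open>(n choose k) X\<^sup>k (1 - X)\<^sup>n\<^sup>-\<^sup>k\<close>, as formal polynomials, so that
  a linear functional can be applied to them.
\<close>
definition bernstein_poly :: "nat \<Rightarrow> nat \<Rightarrow> real poly" where
  "bernstein_poly n k = smult (real (n choose k)) ([:0, 1:] ^ k * [:1, -1:] ^ (n - k))"

lemma sum_bernstein_poly: "(\<Sum>k\<le>n. bernstein_poly n k) = 1"
proof -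
  have "(\<Sum>k\<le>n. bernstein_poly n k) = ([:0, 1:] + [:1, -1:]) ^ n"
    unfolding binomial_ring bernstein_poly_def
    by (simp add: of_nat_poly mult.assoc)
  also have "[:0, 1:] + [:1, -1:] = (1 :: real poly)"
    by simp
  finally show ?thesis by simp
qed

text \<open>
  The factorial moments of the binomial distribution, as an identity of polynomials. Choosing the
  nodal function \<open>k choose m\<close> instead of \<open>k\<^sup>m\<close> leaves no lower-order terms.
\<close>
lemma sum_choose_bernstein_poly:
  assumes "m \<le> n"
  shows "(\<Sum>k\<le>n. smult (real (k choose m)) (bernstein_poly n k)) = smult (real (n choose m)) ([:0, 1:] ^ m)"
proof -
  have "(\<Sum>k\<le>n. smult (real (k choose m)) (bernstein_poly n k))
      = (\<Sum>k\<in>{m..n}. smult (real (k choose m)) (bernstein_poly n k))"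
    by (intro sum.mono_neutral_right) auto
  also have "\<dots> = (\<Sum>j\<le>n - m. smult (real ((m + j) choose m)) (bernstein_poly n (m + j)))"
    using assms
    by (intro sum.reindex_bij_witness[where i = "\<lambda>j. m + j" and j = "\<lambda>k. k - m"]) auto
  also have "\<dots> = (\<Sum>j\<le>n - m. smult (real (n choose m)) ([:0, 1:] ^ m * bernstein_poly (n - m) j))"
  proof (intro sum.cong refl)
    fix j assume "j \<in> {..n - m}"
    then have "(n choose (m + j)) * ((m + j) choose m) = (n choose m) * ((n - m) choose j)"
      using choose_mult[of m "m + j" n] assms by simp
    then have "real ((m + j) choose m) * real (n choose (m + j)) = real (n choose m) * real ((n - m) choose j)"
      by (metis of_nat_mult mult.commute)
    then show "smult (real ((m + j) choose m)) (bernstein_poly n (m + j))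
        = smult (real (n choose m)) ([:0, 1:] ^ m * bernstein_poly (n - m) j)"
      by (simp add: bernstein_poly_def power_add mult.assoc)
  qed
  also have "\<dots> = smult (real (n choose m)) ([:0, 1:] ^ m * (\<Sum>j\<le>n - m. bernstein_poly (n - m) j))"
    using sum_distrib_left[of "smult (real (n choose m)) ([:0, 1:] ^ m)" "bernstein_poly (n - m)" "{..n - m}"]
    by simp
  finally show ?thesis
    by (simp add: sum_bernstein_poly)
qed

lemma choose_ratio_approx:
  assumes n: "2 * m \<le> n" "0 < n" and k: "k \<le> n"
  shows "\<bar>real (k choose m) / real (n choose m) - (real k / real n) ^ m\<bar> \<le> real m * (real m / (real n - real m))"
proof -
  have "real (k choose m) / real (n choose m) = (\<Prod>i<m. (real k - real i) / (real n - real i))"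
    by (simp add: binomial_gbinomial gbinomial_prod_rev prod_dividef atLeast0LessThan)
  moreover have "(real k / real n) ^ m = (\<Prod>i<m. real k / real n)"
    by simp
  ultimately have "\<bar>real (k choose m) / real (n choose m) - (real k / real n) ^ m\<bar>
      = norm ((\<Prod>i<m. (real k - real i) / (real n - real i)) - (\<Prod>i<m. real k / real n))"
    by simp
  also have "\<dots> \<le> (\<Sum>i<m. norm ((real k - real i) / (real n - real i) - real k / real n))"
  proof (rule norm_prod_diff)
    fix i assume "i \<in> {..<m}"
    then have i: "2 * real i \<le> real n" "0 < real n - real i"
      using n by auto
    have "\<bar>real k - real i\<bar> \<le> real n - real i"
      using i k by (auto simp: abs_le_iff)
    then show "norm ((real k - real i) / (real n - real i)) \<le> 1"
      using i by (simp add: abs_divide)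
    show "norm (real k / real n) \<le> 1"
      using k n by simp
  qed
  also have "\<dots> \<le> (\<Sum>i<m. real m / (real n - real m))"
  proof (rule sum_mono)
    fix i assume "i \<in> {..<m}"
    then have i: "real i \<le> real m" "0 < real n - real m"
      using n by auto
    have "(real k - real i) / (real n - real i) - real k / real n
        = - ((real n - real k) / real n * (real i / (real n - real i)))"
      using i by (simp add: field_simps)
    then have "norm ((real k - real i) / (real n - real i) - real k / real n)
        = (real n - real k) / real n * (real i / (real n - real i))"
      using i k by simp
    also have "\<dots> \<le> 1 * (real m / (real n - real m))"
      using i k by (intro mult_mono frac_le) (auto simp: divide_simps)
    finally show "norm ((real k - real i) / (real n - real i) - real k / real n) \<le> real m / (real n - real m)"
      by simp
  qed
  finally show ?thesis
    by simp
qed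

text \<open>
  Hausdorff's theorem: complete monotonicity of the moments is exactly nonnegativity of the
  functional on the products \<open>X\<^sup>j (1 - X)\<^sup>k\<close>. The weights \<open>\<Lambda>\<close> of the Bernstein polynomials of degree \<open>n\<close>,
  placed at the nodes \<open>k / n\<close>, form a probability measure. Its normalised factorial moments
  are those of \<open>\<Lambda>\<close>, so its ordinary moments converge to those of \<open>\<Lambda>\<close>; Helly's selection theorem
  supplies a limiting distribution.
\<close>
lemma hausdorff_moment_problem:
  fixes \<Lambda> :: "real poly \<Rightarrow> real"
  assumes add: "\<And>p r. \<Lambda> (p + r) = \<Lambda> p + \<Lambda> r"
    and smult: "\<And>c p. \<Lambda> (smult c p) = c * \<Lambda> p"
    and one: "\<Lambda> 1 = 1"
    and nonneg: "\<And>j k. 0 \<le> \<Lambda> ([:0, 1:] ^ j * [:1, -1:] ^ k)"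
  obtains M where "real_distribution M" "AE x in M. x \<in> {0..1}"
    "\<And>p. (\<integral>x. poly p x \<partial>M) = \<Lambda> p"
proof -
  have zero: "\<Lambda> 0 = 0"
    using smult[of 0 0] by simp
  have sum: "\<Lambda> (\<Sum>i\<in>A. h i) = (\<Sum>i\<in>A. \<Lambda> (h i))" if "finite A" for h and A :: "nat set"
    using that by induction (simp_all add: zero add)
  define w where "w n k = (if k \<le> n then \<Lambda> (bernstein_poly n k) else 0)" for n k
  have w_nonneg: "0 \<le> w n k" for n k
    using nonneg by (simp add: w_def bernstein_poly_def smult)
  have w_sum: "(\<Sum>k\<le>n. w n k) = 1" for n
    using sum[of "{..n}" "bernstein_poly n"] one by (simp add: w_def sum_bernstein_poly)
  have w_prob: "(\<integral>\<^sup>+k. ennreal (w n k) \<partial>count_space UNIV) = 1" for n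
  proof -
    have "(\<integral>\<^sup>+k. ennreal (w n k) \<partial>count_space UNIV) = (\<Sum>k\<le>n. ennreal (w n k))"
      by (rule nn_integral_count_space') (auto simp: w_def)
    then show ?thesis
      by (simp add: w_nonneg w_sum)
  qed
  define B where "B n = embed_pmf (w n)" for n
  have pmf_B: "pmf (B n) k = w n k" for n k
    unfolding B_def by (rule pmf_embed_pmf[OF w_nonneg w_prob])
  define \<mu> where "\<mu> n = distr (measure_pmf (B n)) borel (\<lambda>k. real k / real n)" for n
  have \<mu>_dist: "real_distribution (\<mu> n)" for n
    unfolding \<mu>_def real_distribution_def real_distribution_axioms_def
    by (auto intro!: measure_pmf.prob_space_distr)
  have \<mu>_int: "integral\<^sup>L (\<mu> n) f = (\<Sum>k\<le>n. f (real k / real n) * w n k)"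
    if [measurable]: "f \<in> borel_measurable borel" for n and f :: "real \<Rightarrow> real"
  proof -
    have "integral\<^sup>L (\<mu> n) f = (\<integral>k. f (real k / real n) \<partial>measure_pmf (B n))"
      unfolding \<mu>_def by (rule integral_distr) auto
    also have "\<dots> = (\<Sum>k\<le>n. f (real k / real n) * pmf (B n) k)"
      by (rule integral_measure_pmf_real) (auto simp: set_pmf_iff pmf_B w_def split: if_splits)
    finally show ?thesis
      by (simp add: pmf_B)
  qed
  \<comment> \<open>Tightness is formulated with half-open intervals, so the node \<open>0\<close> needs a negative left end.\<close>
  have \<mu>_unit: "measure (\<mu> n) {-1<..1} = 1" for n
  proof -
    have "measure (\<mu> n) {-1<..1} = (\<integral>x. indicator {-1<..1} x \<partial>\<mu> n)"
      by (simp add: \<mu>_def)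
    also have "\<dots> = (\<Sum>k\<le>n. w n k)"
      by (subst \<mu>_int) (auto intro!: sum.cong simp: divide_simps indicator_def)
    finally show ?thesis
      by (simp add: w_sum)
  qed
  have tight: "tight \<mu>"
    unfolding tight_def
    by (intro conjI allI impI \<mu>_dist exI[of _ "-1"] exI[of _ "1"]) (simp_all add: \<mu>_unit)
  obtain r M where r: "strict_mono r" and M: "real_distribution M" and conv: "weak_conv_m (\<mu> \<circ> id \<circ> r) M"
    using tight_imp_convergent_subsubsequence[OF tight, of id] by (auto simp: strict_mono_def)
  \<comment> \<open>Retracting the line onto the unit interval turns powers into bounded functions, and puts the limit on it.\<close>
  define clamp :: "real \<Rightarrow> real" where "clamp x = max 0 (min 1 x)" for x
  have clamp_meas [measurable]: "clamp \<in> borel_measurable borel"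
    unfolding clamp_def[abs_def] by measurable
  define N where "N = distr M borel clamp"
  interpret M: real_distribution M by (rule M)
  have N: "real_distribution N"
    unfolding N_def real_distribution_def real_distribution_axioms_def
    by (auto intro!: M.prob_space_distr)
  have N_unit: "AE x in N. x \<in> {0..1}"
    unfolding N_def by (subst AE_distr_iff) (auto simp: clamp_def)
  have power_N: "(\<integral>x. x ^ m \<partial>N) = \<Lambda> ([:0, 1:] ^ m)" for m
  proof -
    have "(\<lambda>n. integral\<^sup>L ((\<mu> \<circ> id \<circ> r) n) (\<lambda>x. clamp x ^ m)) \<longlonglongrightarrow> (\<integral>x. clamp x ^ m \<partial>M)"
    proof (rule weak_conv_imp_integral_bdd_continuous_conv[OF _ M conv])
      show "isCont (\<lambda>x. clamp x ^ m) x" for x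
        unfolding clamp_def by (intro continuous_intros)
      show "norm (clamp x ^ m) \<le> 1" for x
        by (simp add: clamp_def power_le_one)
    qed (simp add: \<mu>_dist)
    then have lim1: "(\<lambda>n. integral\<^sup>L (\<mu> (r n)) (\<lambda>x. clamp x ^ m)) \<longlonglongrightarrow> (\<integral>x. x ^ m \<partial>N)"
      by (simp add: N_def integral_distr)
    have "(\<lambda>n. integral\<^sup>L (\<mu> n) (\<lambda>x. clamp x ^ m)) \<longlonglongrightarrow> \<Lambda> ([:0, 1:] ^ m)"
    proof (rule Lim_transform2[OF tendsto_const], rule Lim_null_comparison)
      show "\<forall>\<^sub>F n in sequentially. norm (\<Lambda> ([:0, 1:] ^ m) - integral\<^sup>L (\<mu> n) (\<lambda>x. clamp x ^ m))
          \<le> real m * (real m / (real n - real m))"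
        using eventually_ge_at_top[of "2 * m"] eventually_gt_at_top[of 0]
      proof eventually_elim
        case (elim n)
        have "\<Lambda> (smult (real (n choose m)) ([:0, 1:] ^ m)) = (\<Sum>k\<le>n. real (k choose m) * w n k)"
          using sum_choose_bernstein_poly[of m n, symmetric] elim(1)
          by (simp add: sum smult w_def)
        then have L: "\<Lambda> ([:0, 1:] ^ m) = (\<Sum>k\<le>n. real (k choose m) / real (n choose m) * w n k)"
          using elim(1) by (simp add: smult sum_divide_distrib[symmetric] field_simps)
        have I: "integral\<^sup>L (\<mu> n) (\<lambda>x. clamp x ^ m) = (\<Sum>k\<le>n. (real k / real n) ^ m * w n k)"
          by (subst \<mu>_int) (auto intro!: sum.cong simp: clamp_def divide_simps)
        have "norm (\<Lambda> ([:0, 1:] ^ m) - integral\<^sup>L (\<mu> n) (\<lambda>x. clamp x ^ m))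
            = \<bar>\<Sum>k\<le>n. (real (k choose m) / real (n choose m) - (real k / real n) ^ m) * w n k\<bar>"
          by (simp add: L I sum_subtractf left_diff_distrib)
        also have "\<dots> \<le> (\<Sum>k\<le>n. \<bar>(real (k choose m) / real (n choose m) - (real k / real n) ^ m) * w n k\<bar>)"
          by (rule sum_abs)
        also have "\<dots> \<le> (\<Sum>k\<le>n. real m * (real m / (real n - real m)) * w n k)"
          unfolding abs_mult using elim w_nonneg
          by (intro sum_mono mult_mono choose_ratio_approx) auto
        also have "\<dots> = real m * (real m / (real n - real m))"
          unfolding sum_distrib_left[symmetric] by (simp add: w_sum)
        finally show ?case .
      qed
      show "(\<lambda>n. real m * (real m / (real n - real m))) \<longlonglongrightarrow> 0"
        by real_asymp
    qed
    from LIMSEQ_subseq_LIMSEQ[OF this r]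
    have "(\<lambda>n. integral\<^sup>L (\<mu> (r n)) (\<lambda>x. clamp x ^ m)) \<longlonglongrightarrow> \<Lambda> ([:0, 1:] ^ m)"
      unfolding o_def .
    with lim1 show ?thesis
      by (rule LIMSEQ_unique)
  qed
  show ?thesis
  proof
    show "real_distribution N" "AE x in N. x \<in> {0..1}" by fact+
    fix p :: "real poly"
    have "integrable N (\<lambda>x. x ^ k)" for k
      using N_unit by (intro integrable_continuous_AE_bounded[OF N, of 1] continuous_intros) auto
    then have "(\<integral>x. poly p x \<partial>N) = (\<Sum>k\<le>degree p. coeff p k * \<Lambda> ([:0, 1:] ^ k))"
      by (simp add: integral_poly_moments power_N)
    also have "\<dots> = \<Lambda> (\<Sum>k\<le>degree p. smult (coeff p k) ([:0, 1:] ^ k))"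
      by (simp add: sum smult)
    also have "(\<Sum>k\<le>degree p. smult (coeff p k) ([:0, 1:] ^ k)) = p"
      by (rule poly_as_sum_of_monoms[of p, unfolded monom_altdef])
    finally show "(\<integral>x. poly p x \<partial>N) = \<Lambda> p" .
  qed
qed

section \<open>Positive functionals with bounded multiplication operator\<close>

lemma pcompose_power: "pcompose (p ^ n) r = pcompose p r ^ n"
  for p r :: "'a::comm_semiring_1 poly"
  by (induction n) (simp_all add: pcompose_mult pcompose_1)

text \<open>
  A positive functional on polynomials for which multiplication by \<open>y\<close> has norm at most \<open>C\<close> in the
  seminorm \<open>p \<mapsto> sqrt (L (p p))\<close> is integration against a distribution on \<open>[-C, C]\<close>. Positivity and
  boundedness give nonnegativity of \<open>L\<close> on \<open>p\<^sup>2\<close> and \<open>(C\<^sup>2 - y\<^sup>2) p\<^sup>2\<close>; the identity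
  \<open>2 C (C \<plusminus> y) = (C \<plusminus> y)\<^sup>2 + (C\<^sup>2 - y\<^sup>2)\<close> extends this to \<open>(C \<plusminus> y) p\<^sup>2\<close>, and splitting off even powers
  yields all \<open>(C + y)\<^sup>j (C - y)\<^sup>k\<close>. An affine substitution then leads to the unit interval.
\<close>
lemma positive_functional_represented:
  fixes L :: "real poly \<Rightarrow> real"
  assumes add: "\<And>p r. L (p + r) = L p + L r"
    and smult: "\<And>c p. L (smult c p) = c * L p"
    and one: "L 1 = 1"
    and pos: "\<And>p. 0 \<le> L (p * p)"
    and bdd: "\<And>p. L (([:0, 1:] * p) * ([:0, 1:] * p)) \<le> C\<^sup>2 * L (p * p)"
    and C: "0 < C"
  obtains M where "real_distribution M" "AE y in M. \<bar>y\<bar> \<le> C"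
    "\<And>p. (\<integral>y. poly p y \<partial>M) = L p"
proof -
  define U V :: "real poly" where "U = [:C, 1:]" and "V = [:C, -1:]"
  have UV: "0 \<le> L (U * V * (p * p))" for p
  proof -
    have "smult (C\<^sup>2) (p * p) = U * V * (p * p) + ([:0, 1:] * p) * ([:0, 1:] * p)"
      by (rule poly_eq_poly_eq_iff[THEN iffD1])
        (simp add: fun_eq_iff U_def V_def power2_eq_square algebra_simps)
    then have "C\<^sup>2 * L (p * p) = L (U * V * (p * p)) + L (([:0, 1:] * p) * ([:0, 1:] * p))"
      by (metis add smult)
    with bdd[of p] show ?thesis by linarith
  qed
  have half: "0 \<le> L (W * (p * p))"
    if "smult (2 * C) W = W * W + U * V" for W p
  proof -
    have "smult (2 * C) (W * (p * p)) = (W * p) * (W * p) + U * V * (p * p)"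
      using arg_cong[OF that, of "\<lambda>r. r * (p * p)"] by (simp add: algebra_simps)
    then have "2 * C * L (W * (p * p)) = L ((W * p) * (W * p)) + L (U * V * (p * p))"
      by (metis add smult)
    then have "0 \<le> 2 * C * L (W * (p * p))"
      using pos[of "W * p"] UV[of p] by linarith
    then show ?thesis
      using C by (simp add: zero_le_mult_iff)
  qed
  have U: "0 \<le> L (U * (p * p))" and V: "0 \<le> L (V * (p * p))" for p
    by (rule half; simp add: U_def V_def)+
  have UV_powers: "0 \<le> L (U ^ j * V ^ k)" for j k
  proof -
    define p where "p = U ^ (j div 2) * V ^ (k div 2)"
    have "U ^ j = U ^ (j mod 2) * (U ^ (j div 2) * U ^ (j div 2))"
      "V ^ k = V ^ (k mod 2) * (V ^ (k div 2) * V ^ (k div 2))"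
      by (simp_all flip: power_add mult_2)
    then have "U ^ j * V ^ k = U ^ (j mod 2) * V ^ (k mod 2) * (p * p)"
      by (simp add: p_def algebra_simps)
    moreover have "j mod 2 = 0 \<or> j mod 2 = 1" "k mod 2 = 0 \<or> k mod 2 = 1"
      by auto
    ultimately show ?thesis
      using pos[of p] U[of p] V[of p] UV[of p] by auto
  qed
  define T :: "real poly" where "T = [:1 / 2, 1 / (2 * C):]"
  define \<Lambda> where "\<Lambda> p = L (pcompose p T)" for p
  obtain N where N: "real_distribution N" "AE x in N. x \<in> {0..1}" "\<And>p. (\<integral>x. poly p x \<partial>N) = \<Lambda> p"
  proof (rule hausdorff_moment_problem)
    show "\<Lambda> (p + r) = \<Lambda> p + \<Lambda> r" "\<Lambda> (smult c p) = c * \<Lambda> p" "\<Lambda> 1 = 1" for p r c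
      by (simp_all add: \<Lambda>_def pcompose_add pcompose_smult pcompose_1 add smult one)
    fix j k
    have "pcompose [:0, 1:] T = smult (1 / (2 * C)) U" "pcompose [:1, -1:] T = smult (1 / (2 * C)) V"
      using C by (simp_all add: T_def U_def V_def pcompose_pCons)
    then have "pcompose ([:0, 1:] ^ j * [:1, -1:] ^ k) T = smult ((1 / (2 * C)) ^ (j + k)) (U ^ j * V ^ k)"
      by (simp add: pcompose_mult pcompose_power smult_power power_add mult.commute)
    then show "0 \<le> \<Lambda> ([:0, 1:] ^ j * [:1, -1:] ^ k)"
      using UV_powers C unfolding \<Lambda>_def by (simp add: smult)
  qed blast
  interpret N: real_distribution N by (rule N)
  define M where "M = distr N borel (\<lambda>x. C * (2 * x - 1))"
  show ?thesis
  proof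
    show "real_distribution M"
      unfolding M_def real_distribution_def real_distribution_axioms_def
      by (auto intro!: N.prob_space_distr)
    have "AE x in N. \<bar>C * (2 * x - 1)\<bar> \<le> C"
      using N(2)
    proof eventually_elim
      case (elim x)
      then have "\<bar>2 * x - 1\<bar> \<le> 1" by auto
      then have "C * \<bar>2 * x - 1\<bar> \<le> C * 1"
        using C by (intro mult_left_mono) auto
      then show ?case
        using C by (simp add: abs_mult)
    qed
    then show "AE y in M. \<bar>y\<bar> \<le> C"
      unfolding M_def by (subst AE_distr_iff) auto
    fix p :: "real poly"
    have "(\<integral>y. poly p y \<partial>M) = (\<integral>x. poly p (C * (2 * x - 1)) \<partial>N)"
      unfolding M_def
      by (rule integral_distr) (auto intro!: borel_measurable_continuous_onI continuous_on_poly_UNIV)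
    also have "\<dots> = (\<integral>x. poly (pcompose p [:-C, 2 * C:]) x \<partial>N)"
      by (simp add: poly_pcompose algebra_simps)
    also have "\<dots> = L (pcompose p (pcompose [:-C, 2 * C:] T))"
      by (simp add: N(3) \<Lambda>_def pcompose_assoc)
    also have "pcompose [:-C, 2 * C:] T = [:0, 1:]"
      using C by (simp add: T_def pcompose_pCons)
    finally show "(\<integral>y. poly p y \<partial>M) = L p"
      by simp
  qed
qed

section \<open>Jacobi operators and three-term recurrences\<close>

text \<open>
  The monic polynomials with \<open>y Q\<^sub>n = Q\<^sub>n\<^sub>+\<^sub>1 + a\<^sub>n Q\<^sub>n + b\<^sub>n\<^sub>-\<^sub>1 Q\<^sub>n\<^sub>-\<^sub>1\<close>. The sequence \<open>b\<close> is indexed from \<open>0\<close>: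
  \<open>b\<^sub>0\<close> is the coefficient that couples \<open>Q\<^sub>0\<close> to \<open>Q\<^sub>1\<close>.
\<close>
fun jacobi_poly :: "(nat \<Rightarrow> real) \<Rightarrow> (nat \<Rightarrow> real) \<Rightarrow> nat \<Rightarrow> real poly" where
  "jacobi_poly a b 0 = 1"
| "jacobi_poly a b (Suc 0) = [:- a 0, 1:]"
| "jacobi_poly a b (Suc (Suc n)) =
     [:- a (Suc n), 1:] * jacobi_poly a b (Suc n) - smult (b n) (jacobi_poly a b n)"

text \<open>
  The tridiagonal (Jacobi) operator: multiplication by \<open>y\<close>, expressed on the coefficients of a polynomial
  in the basis \<open>Q\<^sub>0, Q\<^sub>1, \<dots>\<close>. It is not normalised, so it is symmetric only for the weights
  \<open>b\<^sub>0 \<cdots> b\<^sub>n\<^sub>-\<^sub>1\<close>, but its entries are polynomial in \<open>a\<close> and \<open>b\<close> and make sense for \<open>b\<^sub>n = 0\<close>.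
\<close>
definition jacobi_op :: "(nat \<Rightarrow> real) \<Rightarrow> (nat \<Rightarrow> real) \<Rightarrow> (nat \<Rightarrow> real) \<Rightarrow> nat \<Rightarrow> real" where
  "jacobi_op a b v n = (case n of 0 \<Rightarrow> 0 | Suc m \<Rightarrow> v m) + a n * v n + b n * v (Suc n)"

text \<open>
  The \<open>k\<close>-th unit vector.
\<close>
definition basis_seq :: "nat \<Rightarrow> nat \<Rightarrow> real" where
  "basis_seq k n = (if n = k then 1 else 0)"

text \<open>
  The coefficients of \<open>p\<close> in the basis \<open>Q\<^sub>0, Q\<^sub>1, \<dots>\<close>, computed by Horner's scheme as \<open>p(T) e\<^sub>0\<close> for the
  Jacobi operator \<open>T\<close>. The entry at \<open>0\<close> is the functional that orthogonality
  to \<open>Q\<^sub>0 = 1\<close> forces integration to be.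
\<close>
definition jacobi_coeffs :: "(nat \<Rightarrow> real) \<Rightarrow> (nat \<Rightarrow> real) \<Rightarrow> real poly \<Rightarrow> nat \<Rightarrow> real" where
  "jacobi_coeffs a b p = fold_coeffs (\<lambda>c v n. c * basis_seq 0 n + jacobi_op a b v n) p (\<lambda>_. 0)"

lemma jacobi_op_0 [simp]: "jacobi_op a b v 0 = a 0 * v 0 + b 0 * v 1"
  and jacobi_op_Suc [simp]: "jacobi_op a b v (Suc n) = v n + a (Suc n) * v (Suc n) + b (Suc n) * v (Suc (Suc n))"
  by (simp_all add: jacobi_op_def)

lemma jacobi_op_zero [simp]: "jacobi_op a b (\<lambda>_. 0) = (\<lambda>_. 0)"
  by (simp add: jacobi_op_def fun_eq_iff split: nat.split)

lemma jacobi_op_lincomb: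
  "jacobi_op a b (\<lambda>n. r * u n + v n) n = r * jacobi_op a b u n + jacobi_op a b v n"
  by (simp add: jacobi_op_def algebra_simps split: nat.split)

lemma jacobi_coeffs_0 [simp]: "jacobi_coeffs a b 0 = (\<lambda>_. 0)"
  by (simp add: jacobi_coeffs_def)

lemma jacobi_coeffs_pCons [simp]:
  "jacobi_coeffs a b (pCons c p) = (\<lambda>n. c * basis_seq 0 n + jacobi_op a b (jacobi_coeffs a b p) n)"
  by (cases "c = 0 \<and> p = 0") (auto simp: jacobi_coeffs_def)

lemma jacobi_coeffs_smult [simp]: "jacobi_coeffs a b (smult r p) = (\<lambda>n. r * jacobi_coeffs a b p n)"
proof (induction p)
  case (pCons c p)
  then show ?case
    using jacobi_op_lincomb[of a b r "jacobi_coeffs a b p" "\<lambda>_. 0"]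
    by (intro ext) (simp add: algebra_simps)
qed simp

lemma jacobi_coeffs_add: "jacobi_coeffs a b (p + r) = (\<lambda>n. jacobi_coeffs a b p n + jacobi_coeffs a b r n)"
proof (induction p r rule: poly_induct2)
  case (pCons c p d r)
  then show ?case
    using jacobi_op_lincomb[of a b 1 "jacobi_coeffs a b p" "jacobi_coeffs a b r"]
    by (intro ext) (simp add: algebra_simps)
qed simp

lemma jacobi_coeffs_diff: "jacobi_coeffs a b (p - r) = (\<lambda>n. jacobi_coeffs a b p n - jacobi_coeffs a b r n)"
  using jacobi_coeffs_add[of a b p "- r"] jacobi_coeffs_smult[of a b "-1" r] by simp

lemma jacobi_coeffs_1 [simp]: "jacobi_coeffs a b 1 = basis_seq 0"
  by (simp add: one_pCons fun_eq_iff)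

lemma jacobi_coeffs_linear_mult:
  "jacobi_coeffs a b ([:r, 1:] * p) = (\<lambda>n. r * jacobi_coeffs a b p n + jacobi_op a b (jacobi_coeffs a b p) n)"
  by (simp add: jacobi_coeffs_add)

lemma jacobi_coeffs_power_mult:
  "jacobi_coeffs a b ([:0, 1:] ^ k * p) = (jacobi_op a b ^^ k) (jacobi_coeffs a b p)"
  by (induction k) (simp_all add: jacobi_coeffs_linear_mult mult.assoc del: mult_pCons_left)

lemma jacobi_coeffs_poly [simp]: "jacobi_coeffs a b (jacobi_poly a b n) = basis_seq n"
proof (induction a b n rule: jacobi_poly.induct)
  case (2 a b)
  have "jacobi_op a b (basis_seq 0) n = a 0 * basis_seq 0 n + basis_seq 1 n" for n
    by (cases n) (auto simp: basis_seq_def)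
  then show ?case
    by (simp add: fun_eq_iff)
next
  case (3 a b n)
  have "jacobi_op a b (basis_seq (Suc n)) k
      = b n * basis_seq n k + a (Suc n) * basis_seq (Suc n) k + basis_seq (Suc (Suc n)) k" for k
    by (cases k) (auto simp: basis_seq_def)
  with 3 show ?case
    by (intro ext) (simp add: jacobi_coeffs_diff jacobi_coeffs_linear_mult del: mult_pCons_left)
qed simp

lemma jacobi_coeffs_beyond_degree: "degree p < n \<Longrightarrow> jacobi_coeffs a b p n = 0"
proof (induction p arbitrary: n)
  case (pCons c p)
  then obtain m where m: "n = Suc m"
    by (cases n) auto
  show ?case
  proof (cases "p = 0")
    case True
    then show ?thesis by (simp add: m basis_seq_def)
  next
    case False
    with pCons.prems pCons.IH show ?thesis
      by (simp add: m basis_seq_def)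
  qed
qed simp

text \<open>
  The squared norms of the polynomials \<open>Q\<^sub>n\<close> with respect to their measure of orthogonality.
\<close>
definition jacobi_weight :: "(nat \<Rightarrow> real) \<Rightarrow> nat \<Rightarrow> real" where
  "jacobi_weight b n = (\<Prod>k<n. b k)"

lemma jacobi_weight_simps [simp]:
  "jacobi_weight b 0 = 1" "jacobi_weight b (Suc n) = jacobi_weight b n * b n"
  by (simp_all add: jacobi_weight_def)

text \<open>
  Symmetry of the Jacobi operator for the weighted inner product; truncation at \<open>N\<close> leaves
  boundary terms, which vanish for finitely supported sequences and large \<open>N\<close>.
\<close>
lemma jacobi_op_symmetric:
  "(\<Sum>n\<le>N. jacobi_weight b n * (jacobi_op a b u n * v n)) + jacobi_weight b (Suc N) * (u N * v (Suc N))
    = (\<Sum>n\<le>N. jacobi_weight b n * (u n * jacobi_op a b v n)) + jacobi_weight b (Suc N) * (u (Suc N) * v N)"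
  by (induction N) (simp_all add: algebra_simps)

text \<open>
  Orthogonality in algebraic form: the functional \<open>p \<mapsto> jacobi_coeffs a b p 0\<close> turns products of
  polynomials into the weighted inner product of their coefficients.
\<close>
lemma jacobi_functional_mult:
  assumes "degree p + degree r \<le> N"
  shows "jacobi_coeffs a b (p * r) 0
    = (\<Sum>n\<le>N. jacobi_weight b n * (jacobi_coeffs a b p n * jacobi_coeffs a b r n))"
  using assms
proof (induction p arbitrary: r)
  case (pCons c p)
  let ?c = "jacobi_coeffs a b" and ?h = "jacobi_weight b"
  have const: "(\<Sum>n\<le>N. ?h n * (c * basis_seq 0 n * ?c r n)) = c * ?c r 0"
  proof -
    have "(\<Sum>n\<le>N. ?h n * (c * basis_seq 0 n * ?c r n)) = (\<Sum>n\<in>{0}. ?h n * (c * basis_seq 0 n * ?c r n))"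
      by (rule sum.mono_neutral_right) (auto simp: basis_seq_def)
    then show ?thesis by (simp add: basis_seq_def)
  qed
  have "(\<Sum>n\<le>N. ?h n * (jacobi_op a b (?c p) n * ?c r n)) = ?c (p * pCons 0 r) 0"
  proof (cases "p = 0")
    case False
    then have deg: "degree p + degree (pCons 0 r) \<le> N" "degree p < N"
      using pCons.prems by (auto simp: degree_pCons_le intro: order.trans[OF add_left_mono[OF degree_pCons_le]])
    then have "(\<Sum>n\<le>N. ?h n * (jacobi_op a b (?c p) n * ?c r n))
        = (\<Sum>n\<le>N. ?h n * (?c p n * jacobi_op a b (?c r) n))"
      using jacobi_op_symmetric[of b a "?c p" "?c r" N] by (simp add: jacobi_coeffs_beyond_degree)
    also have "\<dots> = ?c (p * pCons 0 r) 0"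
      using pCons.IH[OF deg(1)] by simp
    finally show ?thesis .
  qed simp
  moreover have "pCons c p * r = smult c r + p * pCons 0 r"
    by simp
  ultimately show ?case
    using const
    by (simp add: jacobi_coeffs_add distrib_left distrib_right sum.distrib del: mult_pCons_left mult_pCons_right)
qed simp

lemma jacobi_op_bounded:
  assumes b: "\<And>n. 0 \<le> b n" "\<And>n. b n \<le> B" and a: "\<And>n. \<bar>a n\<bar> \<le> A" and v: "v (Suc N) = 0"
  shows "(\<Sum>n\<le>N. jacobi_weight b n * (jacobi_op a b v n)\<^sup>2)
    \<le> 3 * (2 * B + A\<^sup>2) * (\<Sum>n\<le>N. jacobi_weight b n * (v n)\<^sup>2)"
proof -
  let ?h = "jacobi_weight b"
  let ?S = "\<Sum>n\<le>N. ?h n * (v n)\<^sup>2"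
  define w where "w n = (case n of 0 \<Rightarrow> 0 | Suc m \<Rightarrow> v m)" for n
  have h: "0 \<le> ?h n" for n
    unfolding jacobi_weight_def by (intro prod_nonneg) (use b in auto)
  have B: "0 \<le> B"
    using b[of 0] by linarith
  have "(\<Sum>n\<le>N. ?h n * (jacobi_op a b v n)\<^sup>2)
      \<le> (\<Sum>n\<le>N. 3 * (?h n * (w n)\<^sup>2 + ?h n * (a n * v n)\<^sup>2 + ?h n * (b n * v (Suc n))\<^sup>2))"
  proof (rule sum_mono)
    fix n
    have "(x + y + z)\<^sup>2 \<le> 3 * (x\<^sup>2 + y\<^sup>2 + z\<^sup>2)" for x y z :: real
      using sum_squares_ge_zero[of "x - y" "y - z"] zero_le_power2[of "x - z"]
      by (simp add: power2_eq_square algebra_simps)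
    then have "(jacobi_op a b v n)\<^sup>2 \<le> 3 * ((w n)\<^sup>2 + (a n * v n)\<^sup>2 + (b n * v (Suc n))\<^sup>2)"
      unfolding jacobi_op_def w_def .
    from mult_left_mono[OF this h[of n]]
    show "?h n * (jacobi_op a b v n)\<^sup>2
        \<le> 3 * (?h n * (w n)\<^sup>2 + ?h n * (a n * v n)\<^sup>2 + ?h n * (b n * v (Suc n))\<^sup>2)"
      by (simp add: algebra_simps)
  qed
  also have "\<dots> = 3 * ((\<Sum>n\<le>N. ?h n * (w n)\<^sup>2) + (\<Sum>n\<le>N. ?h n * (a n * v n)\<^sup>2)
      + (\<Sum>n\<le>N. ?h n * (b n * v (Suc n))\<^sup>2))"
    by (simp add: sum.distrib sum_distrib_left)
  also have "\<dots> \<le> 3 * (B * ?S + A\<^sup>2 * ?S + B * ?S)"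
  proof (intro mult_left_mono add_mono)
    have "(\<Sum>n\<le>N. ?h n * (w n)\<^sup>2) \<le> (\<Sum>n\<le>Suc N. ?h n * (w n)\<^sup>2)"
      using h[of "Suc N"] by (simp del: jacobi_weight_simps)
    also have "\<dots> = (\<Sum>n\<le>N. ?h (Suc n) * (v n)\<^sup>2)"
      by (subst sum.atMost_Suc_shift) (simp add: w_def)
    also have "\<dots> \<le> (\<Sum>n\<le>N. B * (?h n * (v n)\<^sup>2))"
    proof (rule sum_mono)
      fix n
      show "?h (Suc n) * (v n)\<^sup>2 \<le> B * (?h n * (v n)\<^sup>2)"
        using mult_right_mono[OF b(2)[of n], of "?h n * (v n)\<^sup>2"] h by (simp add: algebra_simps)
    qed
    finally show "(\<Sum>n\<le>N. ?h n * (w n)\<^sup>2) \<le> B * ?S"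
      by (simp add: sum_distrib_left)
    have "(\<Sum>n\<le>N. ?h n * (a n * v n)\<^sup>2) \<le> (\<Sum>n\<le>N. A\<^sup>2 * (?h n * (v n)\<^sup>2))"
    proof (rule sum_mono)
      fix n
      have "(a n)\<^sup>2 \<le> A\<^sup>2"
        using a[of n] by (intro power2_le_iff_abs_le[THEN iffD2]) auto
      then show "?h n * (a n * v n)\<^sup>2 \<le> A\<^sup>2 * (?h n * (v n)\<^sup>2)"
        using mult_right_mono[of "(a n)\<^sup>2" "A\<^sup>2" "?h n * (v n)\<^sup>2"] h
        by (simp add: power_mult_distrib algebra_simps)
    qed
    then show "(\<Sum>n\<le>N. ?h n * (a n * v n)\<^sup>2) \<le> A\<^sup>2 * ?S"
      by (simp add: sum_distrib_left)
    have "(\<Sum>n\<le>N. ?h n * (b n * v (Suc n))\<^sup>2) \<le> (\<Sum>n\<le>N. B * (?h (Suc n) * (v (Suc n))\<^sup>2))"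
    proof (rule sum_mono)
      fix n
      show "?h n * (b n * v (Suc n))\<^sup>2 \<le> B * (?h (Suc n) * (v (Suc n))\<^sup>2)"
        using mult_right_mono[OF b(2)[of n], of "?h n * b n * (v (Suc n))\<^sup>2"] h b
        by (simp add: power2_eq_square algebra_simps)
    qed
    also have "\<dots> = B * (\<Sum>n\<le>N. ?h (Suc n) * (v (Suc n))\<^sup>2)"
      by (simp only: sum_distrib_left)
    also have "\<dots> \<le> B * ?S"
    proof (rule mult_left_mono[OF _ B])
      have "(\<Sum>n\<le>N. ?h (Suc n) * (v (Suc n))\<^sup>2) \<le> (\<Sum>n\<le>Suc N. ?h n * (v n)\<^sup>2)"
        by (subst sum.atMost_Suc_shift) simp
      also have "\<dots> = ?S"
        using v by simp
      finally show "(\<Sum>n\<le>N. ?h (Suc n) * (v (Suc n))\<^sup>2) \<le> ?S" .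
    qed
    finally show "(\<Sum>n\<le>N. ?h n * (b n * v (Suc n))\<^sup>2) \<le> B * ?S" .
  qed simp
  also have "\<dots> = 3 * (2 * B + A\<^sup>2) * ?S"
    by (simp add: algebra_simps)
  finally show ?thesis .
qed

lemma jacobi_poly_expansion:
  assumes "degree p \<le> N"
  shows "p = (\<Sum>n\<le>N. smult (jacobi_coeffs a b p n) (jacobi_poly a b n))"
  using assms
proof (induction p)
  case (pCons c p)
  let ?Q = "jacobi_poly a b" and ?v = "jacobi_coeffs a b p"
  have telescope: "(\<Sum>n\<le>N. smult (jacobi_op a b v n) (?Q n)) + smult (v N) (?Q (Suc N))
      = [:0, 1:] * (\<Sum>n\<le>N. smult (v n) (?Q n)) + smult (b N * v (Suc N)) (?Q N)" for v
  proof (induction N)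
    case 0
    show ?case by (simp add: algebra_simps)
  next
    case (Suc N)
    have "smult (v (Suc N)) (?Q (Suc (Suc N)))
        = [:0, 1:] * smult (v (Suc N)) (?Q (Suc N)) - smult (a (Suc N) * v (Suc N)) (?Q (Suc N))
          - smult (b N * v (Suc N)) (?Q N)"
      by (simp add: smult_diff_right mult.commute)
    with Suc.IH show ?case
      by (simp add: smult_add_left distrib_left del: jacobi_poly.simps mult_pCons_left)
  qed
  have one: "(\<Sum>n\<le>N. smult (c * basis_seq 0 n) (?Q n)) = [:c:]"
  proof -
    have "(\<Sum>n\<le>N. smult (c * basis_seq 0 n) (?Q n)) = (\<Sum>n\<in>{0}. smult (c * basis_seq 0 n) (?Q n))"
      by (rule sum.mono_neutral_right) (auto simp: basis_seq_def)
    then show ?thesis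
      by (simp add: basis_seq_def)
  qed
  have "(\<Sum>n\<le>N. smult (jacobi_op a b ?v n) (?Q n)) = pCons 0 p"
  proof (cases "p = 0")
    case False
    with pCons.prems have "degree p < N" "degree p \<le> N"
      by auto
    then have "?v N = 0" "?v (Suc N) = 0" "p = (\<Sum>n\<le>N. smult (?v n) (?Q n))"
      using pCons.IH by (auto simp: jacobi_coeffs_beyond_degree)
    with telescope[of ?v] show ?thesis
      by simp
  qed simp
  with one show ?case
    by (simp add: smult_add_left sum.distrib)
qed simp

section \<open>Measures of orthogonality\<close>

lemma poly_jacobi_expansion:
  "poly p = (\<lambda>y. \<Sum>n\<le>degree p. jacobi_coeffs a b p n * poly (jacobi_poly a b n) y)"
  by (subst (1) jacobi_poly_expansion[OF order_refl, of p a b])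
    (simp add: poly_sum fun_eq_iff)

lemma power_eq_poly: "(\<lambda>y::real. y ^ k) = poly ([:0, 1:] ^ k)"
  by (simp add: fun_eq_iff poly_power)

lemma orthogonality_measure_integrable:
  assumes "orthogonality_measure (jacobi_poly a b) M"
  shows "integrable M (poly p)"
proof -
  have "integrable M (\<lambda>y. poly (jacobi_poly a b n) y * poly (jacobi_poly a b 0) y)" for n
    using assms unfolding orthogonality_measure_def by blast
  then have "integrable M (poly (jacobi_poly a b n))" for n
    by simp
  then show ?thesis
    unfolding poly_jacobi_expansion[of p a b]
    by (intro Bochner_Integration.integrable_sum integrable_mult_right)
qed

lemma orthogonality_measure_integral:
  assumes "orthogonality_measure (jacobi_poly a b) M"
  shows "(\<integral>y. poly p y \<partial>M) = jacobi_coeffs a b p 0"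
proof -
  interpret real_distribution M
    using assms by (simp add: orthogonality_measure_def)
  have zero: "(\<integral>y. poly (jacobi_poly a b n) y \<partial>M) = 0" if "n \<noteq> 0" for n
  proof -
    have "(\<integral>y. poly (jacobi_poly a b n) y * poly (jacobi_poly a b 0) y \<partial>M) = 0"
      using assms that unfolding orthogonality_measure_def by blast
    then show ?thesis by simp
  qed
  let ?N = "degree p"
  have "(\<integral>y. poly p y \<partial>M) = (\<integral>y. (\<Sum>n\<le>?N. jacobi_coeffs a b p n * poly (jacobi_poly a b n) y) \<partial>M)"
    by (simp only: poly_jacobi_expansion[of p a b])
  also have "\<dots> = (\<Sum>n\<le>?N. jacobi_coeffs a b p n * (\<integral>y. poly (jacobi_poly a b n) y \<partial>M))"
    by (simp add: orthogonality_measure_integrable[OF assms])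
  also have "\<dots> = (\<Sum>n\<in>{0}. jacobi_coeffs a b p n * (\<integral>y. poly (jacobi_poly a b n) y \<partial>M))"
    by (rule sum.mono_neutral_right) (auto simp: zero)
  finally show ?thesis
    using prob_space by simp
qed

text \<open>
  Favard's theorem for bounded coefficients. No \<open>b n\<close> has to be positive: if \<open>b n = 0\<close>,
  then the measure has finite support, and \<open>Q\<^sub>n\<^sub>+\<^sub>1\<close> and all later polynomials vanish almost everywhere.
\<close>
lemma orthogonality_measure_exists:
  assumes b: "\<And>n. 0 \<le> b n" "\<And>n. b n \<le> B" and a: "\<And>n. \<bar>a n\<bar> \<le> A"
    and C: "0 < C" "3 * (2 * B + A\<^sup>2) \<le> C\<^sup>2"
  obtains M where "orthogonality_measure (jacobi_poly a b) M" "AE y in M. \<bar>y\<bar> \<le> C"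
proof -
  define L where "L p = jacobi_coeffs a b p 0" for p
  have h: "0 \<le> jacobi_weight b n" for n
    unfolding jacobi_weight_def by (intro prod_nonneg) (use b in auto)
  have square: "L (p * p) = (\<Sum>n\<le>N. jacobi_weight b n * (jacobi_coeffs a b p n)\<^sup>2)"
    if "2 * degree p \<le> N" for p N
    unfolding L_def using jacobi_functional_mult[of p p N a b] that by (simp add: power2_eq_square)
  obtain M where M: "real_distribution M" "AE y in M. \<bar>y\<bar> \<le> C" "\<And>p. (\<integral>y. poly p y \<partial>M) = L p"
  proof (rule positive_functional_represented)
    show "L (p + r) = L p + L r" "L (smult c p) = c * L p" "L 1 = 1" for p r c
      by (simp_all add: L_def jacobi_coeffs_add) (simp add: basis_seq_def)
    show pos: "0 \<le> L (p * p)" for p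
      by (subst square[OF order_refl]) (auto intro!: sum_nonneg mult_nonneg_nonneg h)
    fix p :: "real poly"
    let ?N = "2 * degree p + 2"
    have "degree ([:0, 1:] * p) \<le> Suc (degree p)"
      using degree_mult_le[of "[:0, 1:]" p] by simp
    then have "L (([:0, 1:] * p) * ([:0, 1:] * p))
        = (\<Sum>n\<le>?N. jacobi_weight b n * (jacobi_op a b (jacobi_coeffs a b p) n)\<^sup>2)"
      by (subst square[of _ ?N])
        (simp_all add: jacobi_coeffs_linear_mult del: mult_pCons_left sum.atMost_Suc)
    also have "\<dots> \<le> 3 * (2 * B + A\<^sup>2) * (\<Sum>n\<le>?N. jacobi_weight b n * (jacobi_coeffs a b p n)\<^sup>2)"
      by (intro jacobi_op_bounded a b jacobi_coeffs_beyond_degree) simp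
    also have "\<dots> = 3 * (2 * B + A\<^sup>2) * L (p * p)"
      by (subst square[of p ?N]) simp_all
    also have "\<dots> \<le> C\<^sup>2 * L (p * p)"
      by (intro mult_right_mono C pos)
    finally show "L (([:0, 1:] * p) * ([:0, 1:] * p)) \<le> C\<^sup>2 * L (p * p)" .
  qed (use C in auto)
  have "orthogonality_measure (jacobi_poly a b) M"
    unfolding orthogonality_measure_def
  proof (intro conjI allI impI)
    fix m n
    show "integrable M (\<lambda>y. poly (jacobi_poly a b m) y * poly (jacobi_poly a b n) y)"
      by (intro integrable_continuous_AE_bounded[OF M(1,2)] continuous_intros)
    assume "m \<noteq> n"
    then have "L (jacobi_poly a b m * jacobi_poly a b n) = 0"
      unfolding L_def by (subst jacobi_functional_mult[OF order_refl])
        (auto intro!: sum.neutral simp: basis_seq_def)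
    then show "(\<integral>y. poly (jacobi_poly a b m) y * poly (jacobi_poly a b n) y \<partial>M) = 0"
      using M(3)[of "jacobi_poly a b m * jacobi_poly a b n"] by simp
  qed (rule M)
  with M(2) show ?thesis
    by (rule that[rotated])
qed

lemma orthogonality_measure_The:
  assumes b: "\<And>n. 0 \<le> b n" "\<And>n. b n \<le> B" and a: "\<And>n. \<bar>a n\<bar> \<le> A"
    and C: "0 < C" "3 * (2 * B + A\<^sup>2) \<le> C\<^sup>2"
  defines "M \<equiv> THE M. orthogonality_measure (jacobi_poly a b) M"
  shows "orthogonality_measure (jacobi_poly a b) M" and "AE y in M. \<bar>y\<bar> \<le> C"
proof -
  obtain N where N: "orthogonality_measure (jacobi_poly a b) N" "AE y in N. \<bar>y\<bar> \<le> C"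
    by (rule orthogonality_measure_exists[OF b a C])
  have "M = N"
    unfolding M_def
  proof (rule the_equality)
    fix K assume K: "orthogonality_measure (jacobi_poly a b) K"
    show "K = N"
    proof (rule real_distribution_determined_by_moments[OF _ N(2) C(1)])
      show "real_distribution K" "real_distribution N"
        using K N by (simp_all add: orthogonality_measure_def)
      show "integrable K (\<lambda>y. y ^ k)" for k
        by (subst power_eq_poly) (rule orthogonality_measure_integrable[OF K])
      show "(\<integral>y. y ^ k \<partial>K) = (\<integral>y. y ^ k \<partial>N)" for k
        using orthogonality_measure_integral[OF K, of "[:0, 1:] ^ k"]
          orthogonality_measure_integral[OF N(1), of "[:0, 1:] ^ k"]
        by (simp add: poly_power)
    qed
  qed (rule N)
  show "orthogonality_measure (jacobi_poly a b) M" "AE y in M. \<bar>y\<bar> \<le> C"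
    unfolding \<open>M = N\<close> by (rule N)+
qed

lemma orthogonality_measure_moment:
  assumes "orthogonality_measure (jacobi_poly a b) M"
  shows "(\<integral>y. y ^ k \<partial>M) = (jacobi_op a b ^^ k) (basis_seq 0) 0"
proof -
  have "(\<integral>y. y ^ k \<partial>M) = jacobi_coeffs a b ([:0, 1:] ^ k * 1) 0"
    using orthogonality_measure_integral[OF assms, of "[:0, 1:] ^ k"] by (simp add: poly_power)
  then show ?thesis
    unfolding jacobi_coeffs_power_mult by simp
qed

text \<open>
  The factor \<open>b 0\<close> is the squared norm of \<open>Q\<^sub>1 = y - a\<^sub>0\<close>. Dividing by it leaves an expression that is
  continuous in the coefficients, even where \<open>b 0 = 0\<close>.
\<close>
lemma orthogonality_measure_quadratic_moment:
  assumes "orthogonality_measure (jacobi_poly a b) M"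
  shows "(\<integral>y. (y - a 0)\<^sup>2 * y ^ k \<partial>M) = b 0 * (jacobi_op a b ^^ k) (basis_seq 1) 1"
proof -
  let ?Q = "jacobi_poly a b 1"
  have "(\<integral>y. (y - a 0)\<^sup>2 * y ^ k \<partial>M) = (\<integral>y. poly (?Q * ([:0, 1:] ^ k * ?Q)) y \<partial>M)"
    by (simp add: poly_power power2_eq_square algebra_simps)
  also have "\<dots> = jacobi_coeffs a b (?Q * ([:0, 1:] ^ k * ?Q)) 0"
    by (rule orthogonality_measure_integral[OF assms])
  also have "\<dots> = (\<Sum>n\<le>degree ?Q + degree ([:0, 1:] ^ k * ?Q).
      jacobi_weight b n * (basis_seq 1 n * (jacobi_op a b ^^ k) (basis_seq 1) n))"
    by (subst jacobi_functional_mult[OF order_refl])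
      (simp only: jacobi_coeffs_power_mult jacobi_coeffs_poly)
  also have "\<dots> = (\<Sum>n\<in>{1}. jacobi_weight b n * (basis_seq 1 n * (jacobi_op a b ^^ k) (basis_seq 1) n))"
    by (rule sum.mono_neutral_right) (auto simp: basis_seq_def)
  finally show ?thesis
    by (simp add: basis_seq_def)
qed

lemma tendsto_jacobi_op_power:
  assumes a: "\<And>n. ((\<lambda>i. a i n) \<longlongrightarrow> a' n) F" and b: "\<And>n. ((\<lambda>i. b i n) \<longlongrightarrow> b' n) F"
  shows "((\<lambda>i. (jacobi_op (a i) (b i) ^^ k) v n) \<longlongrightarrow> (jacobi_op a' b' ^^ k) v n) F"
proof (induction k arbitrary: n)
  case (Suc k)
  show ?case
    by (cases n) (auto intro!: tendsto_intros a b Suc.IH)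
qed simp

text \<open>
  For \<open>b 0 = 0\<close> a vector orthogonal to the zeroth unit vector stays so, and on such vectors the
  operator acts as the Jacobi operator with the zeroth row and column deleted.
\<close>
lemma jacobi_op_power_decoupled:
  assumes "b 0 = 0"
  shows "(jacobi_op a b ^^ k) (basis_seq 1) 0 = 0"
    "(jacobi_op a b ^^ k) (basis_seq 1) (Suc n)
      = (jacobi_op (\<lambda>n. a (Suc n)) (\<lambda>n. b (Suc n)) ^^ k) (basis_seq 0) n"
proof (induction k arbitrary: n)
  case (Suc k)
  { case 1 then show ?case using Suc assms by simp }
  { case 2 then show ?case using Suc by (cases n) simp_all }
qed (simp_all add: basis_seq_def)

section \<open>The q-Meixner polynomials\<close>

lemma q_int_geometric:
  assumes "q < 1"
  shows "(1 - q) * q_int q n = 1 - q ^ n"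
  using assms by (simp add: q_int_def one_diff_power_eq)

lemma q_int_bounds:
  assumes "-1 < q" "q < 1"
  shows "0 \<le> q_int q n" "q_int q n \<le> 2 / (1 - q)"
proof -
  have "\<bar>q ^ n\<bar> \<le> 1"
    using assms by (simp add: power_abs power_le_one)
  moreover have "q_int q n = (1 - q ^ n) / (1 - q)"
    using q_int_geometric[of q n] assms by (simp add: field_simps)
  ultimately show "0 \<le> q_int q n" "q_int q n \<le> 2 / (1 - q)"
    using assms by (auto intro!: divide_nonneg_pos divide_right_mono)
qed

text \<open>
  The recurrence coefficients of the polynomials \<open>Q\<^sub>n(y|x,s,t)\<close>.
\<close>
definition meixner_a :: "real \<Rightarrow> real \<Rightarrow> real \<Rightarrow> nat \<Rightarrow> real" where
  "meixner_a \<theta> q x n = \<theta> * q_int q n + x * q ^ n"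

definition meixner_b :: "real \<Rightarrow> real \<Rightarrow> real \<Rightarrow> real \<Rightarrow> nat \<Rightarrow> real" where
  "meixner_b \<tau> q s t n = (t - s * q ^ n + \<tau> * q_int q n) * q_int q (Suc n)"

lemma meixner_Q_eq_jacobi:
  "meixner_Q \<theta> \<tau> q x s t = jacobi_poly (meixner_a \<theta> q x) (meixner_b \<tau> q s t)"
proof
  show "meixner_Q \<theta> \<tau> q x s t n = jacobi_poly (meixner_a \<theta> q x) (meixner_b \<tau> q s t) n" for n
    by (induction \<theta> \<tau> q x s t n rule: meixner_Q.induct)
      (simp_all add: meixner_a_def meixner_b_def q_int_def)
qed

lemma meixner_b_diagonal:
  assumes "q < 1"
  shows "meixner_b \<tau> q t t (Suc n) = ((1 - q) * t + \<tau>) * q_int q (Suc n) * q_int q (Suc (Suc n))"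
proof -
  have "t - t * q ^ Suc n = t * ((1 - q) * q_int q (Suc n))"
    by (simp only: q_int_geometric[OF assms] right_diff_distrib mult_1_right)
  then show ?thesis
    unfolding meixner_b_def \<open>t - t * q ^ Suc n = _\<close> by (simp add: algebra_simps)
qed

text \<open>
  The polynomials \<open>W\<^sub>n\<close> have the coefficients of \<open>Q\<^sub>n\<close> at \<open>s = t\<close>, shifted by one index.
\<close>
lemma meixner_W_eq_jacobi:
  assumes "q < 1"
  shows "meixner_W \<theta> \<tau> q x t
    = jacobi_poly (\<lambda>n. meixner_a \<theta> q x (Suc n)) (\<lambda>n. meixner_b \<tau> q t t (Suc n))"
proof
  show "meixner_W \<theta> \<tau> q x t n
      = jacobi_poly (\<lambda>n. meixner_a \<theta> q x (Suc n)) (\<lambda>n. meixner_b \<tau> q t t (Suc n)) n" for n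
    using assms
    by (induction \<theta> \<tau> q x t n rule: meixner_W.induct) (simp_all add: meixner_a_def meixner_b_diagonal)
qed

locale meixner =
  fixes \<theta> \<tau> q x :: real
  assumes \<tau>: "0 \<le> \<tau>" and q: "-1 < q" "q < 1"
begin

abbreviation "a \<equiv> meixner_a \<theta> q x"
abbreviation "b \<equiv> meixner_b \<tau> q"

text \<open>
  Bounds for the coefficients that are uniform over the times \<open>0 \<le> s \<le> t \<le> T\<close>, and the half-width of an
  interval that carries all the measures for such times. The summand \<open>1\<close> only makes the latter positive.
\<close>
definition bound_a :: real where
  "bound_a = \<bar>\<theta>\<bar> * (2 / (1 - q)) + \<bar>x\<bar>"

definition bound_b :: "real \<Rightarrow> real" where
  "bound_b T = (2 * T + \<tau> * (2 / (1 - q))) * (2 / (1 - q))"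

definition radius :: "real \<Rightarrow> real" where
  "radius T = sqrt (3 * (2 * bound_b T + bound_a\<^sup>2)) + 1"

lemma power_q: "\<bar>q ^ n\<bar> \<le> 1"
  using q by (simp add: power_abs power_le_one)

lemma a_bounded: "\<bar>a n\<bar> \<le> bound_a"
proof -
  have "\<bar>a n\<bar> \<le> \<bar>\<theta>\<bar> * q_int q n + \<bar>x\<bar> * \<bar>q ^ n\<bar>"
    unfolding meixner_a_def using q_int_bounds(1)[OF q, of n]
    by (intro order.trans[OF abs_triangle_ineq]) (simp add: abs_mult)
  also have "\<dots> \<le> \<bar>\<theta>\<bar> * (2 / (1 - q)) + \<bar>x\<bar> * 1"
    using q_int_bounds[OF q] power_q by (intro add_mono mult_left_mono) auto
  finally show ?thesis by (simp add: bound_a_def)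
qed

lemma power_q_mult: "0 \<le> s \<Longrightarrow> \<bar>s * q ^ n\<bar> \<le> s"
  using mult_left_mono[OF power_q[of n], of s] by (simp add: abs_mult)

lemma b_bounds:
  assumes "0 \<le> s" "s \<le> t" "t \<le> T"
  shows "0 \<le> b s t n" "b s t n \<le> bound_b T"
proof -
  have st: "0 \<le> t - s * q ^ n" "t - s * q ^ n \<le> 2 * T"
    using power_q_mult[of s n] assms by auto
  have qn: "0 \<le> q_int q n" "q_int q n \<le> 2 / (1 - q)" "0 \<le> q_int q (Suc n)" "q_int q (Suc n) \<le> 2 / (1 - q)"
    using q_int_bounds[OF q] by auto
  show "0 \<le> b s t n"
    unfolding meixner_b_def using st qn \<tau> by (intro mult_nonneg_nonneg add_nonneg_nonneg) auto
  show "b s t n \<le> bound_b T"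
    unfolding meixner_b_def bound_b_def using st qn \<tau> q
    by (intro mult_mono add_mono mult_left_mono add_nonneg_nonneg mult_nonneg_nonneg) auto
qed

lemma radius:
  assumes "0 \<le> T"
  shows "0 < radius T" "3 * (2 * bound_b T + bound_a\<^sup>2) \<le> (radius T)\<^sup>2"
proof -
  have "0 \<le> bound_b T"
    using b_bounds[of 0 T T 0] assms by linarith
  then have *: "0 \<le> 3 * (2 * bound_b T + bound_a\<^sup>2)"
    by simp
  then show "0 < radius T"
    unfolding radius_def using real_sqrt_ge_zero[OF *] by linarith
  have "(sqrt (3 * (2 * bound_b T + bound_a\<^sup>2)))\<^sup>2 \<le> (radius T)\<^sup>2"
    unfolding radius_def using real_sqrt_ge_zero[OF *] by (intro power_mono) auto
  then show "3 * (2 * bound_b T + bound_a\<^sup>2) \<le> (radius T)\<^sup>2"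
    using * by simp
qed

lemma meixner_P:
  assumes "0 \<le> s" "s \<le> t" "t \<le> T"
  shows "orthogonality_measure (jacobi_poly a (b s t)) (meixner_P \<theta> \<tau> q s t x)"
    "AE y in meixner_P \<theta> \<tau> q s t x. \<bar>y\<bar> \<le> radius T"
proof -
  have "0 \<le> T"
    using assms by linarith
  note The = orthogonality_measure_The[of "b s t", OF b_bounds[OF assms] a_bounded radius[OF \<open>0 \<le> T\<close>]]
  show "orthogonality_measure (jacobi_poly a (b s t)) (meixner_P \<theta> \<tau> q s t x)"
    "AE y in meixner_P \<theta> \<tau> q s t x. \<bar>y\<bar> \<le> radius T"
    unfolding meixner_P_def meixner_Q_eq_jacobi by (fact The)+
qed

lemma meixner_nu:
  assumes "0 \<le> t" "t \<le> T"
  shows "orthogonality_measure (jacobi_poly (\<lambda>n. a (Suc n)) (\<lambda>n. b t t (Suc n))) (meixner_nu \<theta> \<tau> q x t)"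
    "AE y in meixner_nu \<theta> \<tau> q x t. \<bar>y\<bar> \<le> radius T"
proof -
  have "0 \<le> T"
    using assms by linarith
  note The = orthogonality_measure_The[of "\<lambda>n. b t t (Suc n)" _ "\<lambda>n. a (Suc n)",
      OF b_bounds[OF assms(1) order_refl assms(2)] a_bounded radius[OF \<open>0 \<le> T\<close>]]
  show "orthogonality_measure (jacobi_poly (\<lambda>n. a (Suc n)) (\<lambda>n. b t t (Suc n))) (meixner_nu \<theta> \<tau> q x t)"
    "AE y in meixner_nu \<theta> \<tau> q x t. \<bar>y\<bar> \<le> radius T"
    unfolding meixner_nu_def meixner_W_eq_jacobi[OF q(2)] by (fact The)+
qed

lemma a_0: "a 0 = x" and b_0: "b s t 0 = t - s"
  by (simp_all add: meixner_a_def meixner_b_def q_int_def)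

lemma meixner_quadratic:
  assumes "0 \<le> s" "s < t" "t \<le> T"
  shows "real_distribution (meixner_quadratic \<theta> \<tau> q s t x)"
    "AE y in meixner_quadratic \<theta> \<tau> q s t x. \<bar>y\<bar> \<le> radius T"
    "(\<integral>y. y ^ k \<partial>meixner_quadratic \<theta> \<tau> q s t x) = (jacobi_op a (b s t) ^^ k) (basis_seq 1) 1"
proof -
  let ?P = "meixner_P \<theta> \<tau> q s t x" and ?g = "\<lambda>y. (y - x)\<^sup>2 / (t - s)"
  have P: "orthogonality_measure (jacobi_poly a (b s t)) ?P" "AE y in ?P. \<bar>y\<bar> \<le> radius T"
    using meixner_P[of s t T] assms by auto
  interpret P: real_distribution ?P
    using P(1) by (simp add: orthogonality_measure_def)
  have g: "0 \<le> ?g y" for y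
    using assms by simp
  have int: "integrable ?P ?g"
    using assms by (intro integrable_continuous_AE_bounded[OF P.real_distribution_axioms P(2)] continuous_intros) auto
  have moment: "(\<integral>y. ?g y * y ^ k \<partial>?P) = (jacobi_op a (b s t) ^^ k) (basis_seq 1) 1" for k
    using orthogonality_measure_quadratic_moment[OF P(1), of k] assms
    by (simp add: a_0 b_0 field_simps)
  have "(\<integral>\<^sup>+y. ennreal (?g y) \<partial>?P) = 1"
    using moment[of 0] by (subst nn_integral_eq_integral[OF int]) (simp_all add: g basis_seq_def)
  then have "prob_space (meixner_quadratic \<theta> \<tau> q s t x)"
    unfolding meixner_quadratic_def
    by (intro prob_spaceI) (simp add: emeasure_density)
  then show "real_distribution (meixner_quadratic \<theta> \<tau> q s t x)"
    unfolding real_distribution_def real_distribution_axioms_def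
    by (simp add: meixner_quadratic_def)
  show "AE y in meixner_quadratic \<theta> \<tau> q s t x. \<bar>y\<bar> \<le> radius T"
    unfolding meixner_quadratic_def using P(2) by (subst AE_density) (auto elim: eventually_mono)
  show "(\<integral>y. y ^ k \<partial>meixner_quadratic \<theta> \<tau> q s t x) = (jacobi_op a (b s t) ^^ k) (basis_seq 1) 1"
    unfolding meixner_quadratic_def using moment[of k] g by (subst integral_density) auto
qed

text \<open>
  Both one-sided limits at once: the times \<open>s\<close> and \<open>t\<close> may vary together along any filter,
  as long as \<open>s < t\<close> eventually.
\<close>
lemma meixner_quadratic_converges:
  assumes "0 < u" and s: "(s \<longlongrightarrow> u) F" and t: "(t \<longlongrightarrow> u) F"
    and st: "\<forall>\<^sub>F i in F. s i < t i"
  shows "converges_weakly (\<lambda>i. meixner_quadratic \<theta> \<tau> q (s i) (t i) x) (meixner_nu \<theta> \<tau> q x u) F"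
proof -
  let ?\<mu> = "\<lambda>i. meixner_quadratic \<theta> \<tau> q (s i) (t i) x" and ?\<nu> = "meixner_nu \<theta> \<tau> q x u"
  have "\<forall>\<^sub>F i in F. 0 < s i" "\<forall>\<^sub>F i in F. t i < u + 1"
    using order_tendstoD[OF s] order_tendstoD[OF t] assms(1) by auto
  with st have param: "\<forall>\<^sub>F i in F. 0 \<le> s i \<and> s i < t i \<and> t i \<le> u + 1"
    by eventually_elim auto
  have \<nu>: "orthogonality_measure (jacobi_poly (\<lambda>n. a (Suc n)) (\<lambda>n. b u u (Suc n))) ?\<nu>"
    "AE y in ?\<nu>. \<bar>y\<bar> \<le> radius (u + 1)"
    using meixner_nu[of u "u + 1"] assms(1) by auto
  have dist: "\<forall>\<^sub>F i in F. real_distribution (?\<mu> i) \<and> (AE y in ?\<mu> i. \<bar>y\<bar> \<le> radius (u + 1))"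
    using param by eventually_elim (auto intro: meixner_quadratic)
  have \<nu>_dist: "real_distribution ?\<nu>"
    using \<nu>(1) by (simp add: orthogonality_measure_def)
  have moments: "((\<lambda>i. \<integral>y. y ^ k \<partial>?\<mu> i) \<longlongrightarrow> (\<integral>y. y ^ k \<partial>?\<nu>)) F" for k
  proof -
    have "((\<lambda>i. b (s i) (t i) n) \<longlongrightarrow> b u u n) F" for n
      unfolding meixner_b_def by (intro tendsto_intros s t)
    then have "((\<lambda>i. (jacobi_op a (b (s i) (t i)) ^^ k) (basis_seq 1) 1)
        \<longlongrightarrow> (jacobi_op a (b u u) ^^ k) (basis_seq 1) 1) F"
      by (intro tendsto_jacobi_op_power tendsto_const)
    also have "(jacobi_op a (b u u) ^^ k) (basis_seq 1) 1 = (\<integral>y. y ^ k \<partial>?\<nu>)"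
      using jacobi_op_power_decoupled(2)[of "b u u" k a 0] orthogonality_measure_moment[OF \<nu>(1), of k]
      by (simp add: b_0)
    finally show ?thesis
    proof (rule Lim_transform_eventually)
      show "\<forall>\<^sub>F i in F. (jacobi_op a (b (s i) (t i)) ^^ k) (basis_seq 1) 1 = (\<integral>y. y ^ k \<partial>?\<mu> i)"
        using param by eventually_elim (auto simp: meixner_quadratic(3))
    qed
  qed
  show ?thesis
    unfolding converges_weakly_def
    using dist \<nu>_dist tendsto_integral_of_moments[OF dist \<nu>_dist \<nu>(2) moments]
    by (auto elim: eventually_mono)
qed

end

theorem theorem1p4:
  fixes \<theta> \<tau> q x :: real
  assumes "\<tau> \<ge> 0" and "-1 < q" and "q < 1"
  shows "(\<forall>s t. 0 \<le> s \<and> s < t \<longrightarrow> real_distribution (meixner_quadratic \<theta> \<tau> q s t x)) \<and>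
    (\<forall>t>0. converges_weakly (\<lambda>s. meixner_quadratic \<theta> \<tau> q s t x)
             (meixner_nu \<theta> \<tau> q x t) (at_left t)) \<and>
    (\<forall>s>0. converges_weakly (\<lambda>t. meixner_quadratic \<theta> \<tau> q s t x)
             (meixner_nu \<theta> \<tau> q x s) (at_right s))"
proof -
  interpret meixner \<theta> \<tau> q x
    using assms by unfold_locales
  show ?thesis
  proof (intro conjI allI impI)
    show "real_distribution (meixner_quadratic \<theta> \<tau> q s t x)" if "0 \<le> s \<and> s < t" for s t
      using that meixner_quadratic(1)[of s t t] by simp
    show "converges_weakly (\<lambda>s. meixner_quadratic \<theta> \<tau> q s t x) (meixner_nu \<theta> \<tau> q x t) (at_left t)"
      if "0 < t" for t
      using that by (intro meixner_quadratic_converges tendsto_intros) (simp_all add: eventually_at_filter) 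
    show "converges_weakly (\<lambda>t. meixner_quadratic \<theta> \<tau> q s t x) (meixner_nu \<theta> \<tau> q x s) (at_right s)"
      if "0 < s" for s
      using that by (intro meixner_quadratic_converges tendsto_intros) (simp_all add: eventually_at_filter)
  qed
qed

end
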